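(* Let $\mathbb{A}$ be a partial combinatory algebra with elementary subalgebra $\mathbb{A}'\subseteq\mathbb{A}$, and let $\mathsf{RT}(\mathbb{A},\mathbb{A}')$ be the relative realizability topos. Every Lawvere–Tierney topology on $\mathsf{RT}(\mathbb{A},\mathbb{A}')$ is represented by a map $\mathcal{P}(\mathbb{A})\to\mathcal{P}(\mathbb{A})$ of the form $O_P$ for some partitioned assembly $(X,\rho_X)$ and predicate $P : X\to\mathcal{P}(\mathbb{A})$; equivalently, it is represented by a map of the form $O_f$ for some extended Weihrauch predicate $f:\mathbb{A}\to\mathcal{P}(\mathcal{P}(\mathbb{A}))$.
   Context: Lawvere–Tierney topologies on $\mathsf{RT}(\mathbb{A},\mathbb{A}')$ are represented, as usual in realizability, by maps $J:\mathcal{P}(\mathbb{A})\to\mathcal{P}(\mathbb{A})$ on realizability truth values. Write $c\cdot d$ for application in $\mathbb{A}$, $(c\cdot d)\downarrow$ for "is defined", $\langle\cdot,\cdot\rangle$ for the standard pairing, $\langle x,y,z\rangle := \langle x,\langle y,z\rangle\rangle$, and $\overline{0},\overline{1}$ for the standard numerals. A partitioned assembly $(X,\rho_X)$ is a set $X$ with a map $\rho_X : X\to\mathbb{A}$; a predicate on it is a map $P : X\to\mathcal{P}(\mathbb{A})$. For such $P$ and $S\in\mathcal{P}(\mathbb{A})$, $O_P\,S$ is the least subset of $\mathbb{A}$ satisfying $O_P\,S = \{\langle\overline{0},a\rangle \mid a\in S\}\cup\bigcup_{x\in X}\{\langle\overline{1},\langle\rho_X\,x, c\rangle\rangle\mid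 c\in\mathbb{A},\ \forall d\in P\,x.\,((c\cdot d)\downarrow \wedge c\cdot d\in O_P\,S)\}$. An extended Weihrauch predicate is a map $f:\mathbb{A}\to\mathcal{P}(\mathcal{P}(\mathbb{A}))$; for $S\in\mathcal{P}(\mathbb{A})$, $O_f\,S$ is the least subset satisfying $O_f\,S = \{\langle\overline{0},a\rangle\mid a\in S\}\cup\bigcup_{b\in\mathbb{A}}\bigcup_{\theta\in f\,b}\{\langle\overline{1},b,c\rangle\mid c\in\mathbb{A},\ \forall d\in\theta.\,((c\cdot d)\downarrow\wedge c\cdot d\in O_f\,S)\}$. *)

theory Defs
  imports Main
begin

section \<open>Partial combinatory algebras and elementary subalgebras\<close>

text \<open>Strict application of possibly undefined terms; equality of options is then Kleene equality.\<close>

definition kleene_app :: "('a \<Rightarrow> 'a \<Rightarrow> 'a option) \<Rightarrow> 'a option \<Rightarrow> 'a option \<Rightarrow> 'a option" where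
  "kleene_app app t u = Option.bind t (\<lambda>a. Option.bind u (\<lambda>b. app a b))"

locale pca =
  fixes app :: "'a \<Rightarrow> 'a \<Rightarrow> 'a option"  (infixl "\<cdot>" 70)
    and k s :: 'a
  assumes k_app: "kleene_app app (k \<cdot> x) (Some y) = Some x"
    and s_defined: "kleene_app app (s \<cdot> x) (Some y) \<noteq> None"
    and s_app: "kleene_app app (kleene_app app (s \<cdot> x) (Some y)) (Some z) =
                kleene_app app (x \<cdot> z) (y \<cdot> z)"
begin

text \<open>Only used below for applications that are always defined.\<close>

definition ap :: "'a \<Rightarrow> 'a \<Rightarrow> 'a" where
  "ap a b = the (a \<cdot> b)"

definition idc :: 'a where
  "idc = ap (ap s k) k"

text \<open>The standard pairing \<open>\<lambda>z. z x y\<close>, with the abstraction over \<open>z\<close> expressed by \<open>k\<close> and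
  \<open>s\<close>; the projections are application to \<open>k\<close> and to \<open>k i\<close> (see \<open>pair_app\<close> below).\<close>

definition pair :: "'a \<Rightarrow> 'a \<Rightarrow> 'a" where
  "pair x y = ap (ap s (ap (ap s idc) (ap k x))) (ap k y)"

text \<open>The standard numerals: \<open>0\<close> is \<open>i\<close>, and \<open>n + 1\<close> is the pair of \<open>k i\<close> (false) and \<open>n\<close>.\<close>

primrec num :: "nat \<Rightarrow> 'a" where
  "num 0 = idc"
| "num (Suc n) = pair (ap k idc) (num n)"

lemma k_ap: "k \<cdot> x = Some (ap k x)" "ap k x \<cdot> y = Some x"
  using k_app[of x y] by (auto simp: kleene_app_def ap_def split: Option.bind_split_asm)

lemma s_ap: "s \<cdot> x = Some (ap s x)" "ap s x \<cdot> y = Some (ap (ap s x) y)"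
  "ap (ap s x) y \<cdot> z = kleene_app app (x \<cdot> z) (y \<cdot> z)"
  using s_defined[of x y] s_app[of x y z]
  by (auto simp: kleene_app_def ap_def split: Option.bind_split_asm)

lemma idc_app: "idc \<cdot> x = Some x"
  by (simp add: idc_def s_ap k_ap kleene_app_def)

lemma pair_app: "pair x y \<cdot> z = kleene_app app (z \<cdot> x) (Some y)"
  by (simp add: pair_def s_ap k_ap idc_app kleene_app_def)

subsection \<open>Truth values\<close>

definition tv_imp :: "'a set \<Rightarrow> 'a set \<Rightarrow> 'a set"  (infixr "\<rightharpoonup>" 60) where
  "p \<rightharpoonup> q = {c. \<forall>d\<in>p. \<exists>e. c \<cdot> d = Some e \<and> e \<in> q}"

definition tv_conj :: "'a set \<Rightarrow> 'a set \<Rightarrow> 'a set"  (infixr "\<sqinter>" 65) where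
  "p \<sqinter> q = {pair a b |a b. a \<in> p \<and> b \<in> q}"

definition tv_iff :: "'a set \<Rightarrow> 'a set \<Rightarrow> 'a set"  (infix "\<rightleftharpoons>" 55) where
  "p \<rightleftharpoons> q = (p \<rightharpoonup> q) \<sqinter> (q \<rightharpoonup> p)"

subsection \<open>The maps induced by predicates and by extended Weihrauch predicates\<close>

text \<open>\<open>(X, \<rho>)\<close> is a partitioned assembly and \<open>P\<close> a predicate on it; the values of \<open>\<rho>\<close> and \<open>P\<close>
  outside \<open>X\<close> are irrelevant. The premise on \<open>c\<close> says that \<open>c \<cdot> d\<close> is defined and lies in the set
  being generated.\<close>

inductive_set O_pred :: "'x set \<Rightarrow> ('x \<Rightarrow> 'a) \<Rightarrow> ('x \<Rightarrow> 'a set) \<Rightarrow> 'a set \<Rightarrow> 'a set"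
  for X :: "'x set" and \<rho> :: "'x \<Rightarrow> 'a" and P :: "'x \<Rightarrow> 'a set" and S :: "'a set" where
  ret: "a \<in> S \<Longrightarrow> pair (num 0) a \<in> O_pred X \<rho> P S"
| ask: "x \<in> X \<Longrightarrow> \<forall>d\<in>P x. \<exists>e. c \<cdot> d = Some e \<and> e \<in> O_pred X \<rho> P S
        \<Longrightarrow> pair (num 1) (pair (\<rho> x) c) \<in> O_pred X \<rho> P S"

inductive_set O_weih :: "('a \<Rightarrow> 'a set set) \<Rightarrow> 'a set \<Rightarrow> 'a set"
  for f :: "'a \<Rightarrow> 'a set set" and S :: "'a set" where
  ret: "a \<in> S \<Longrightarrow> pair (num 0) a \<in> O_weih f S"
| ask: "\<theta> \<in> f b \<Longrightarrow> \<forall>d\<in>\<theta>. \<exists>e. c \<cdot> d = Some e \<and> e \<in> O_weih f S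
        \<Longrightarrow> pair (num 1) (pair b c) \<in> O_weih f S"

end

locale elementary_subpca = pca app k s
  for app :: "'a \<Rightarrow> 'a \<Rightarrow> 'a option"  (infixl "\<cdot>" 70) and k s :: 'a +
  fixes A' :: "'a set"
  assumes k_sub: "k \<in> A'"
    and s_sub: "s \<in> A'"
    and app_sub: "a \<in> A' \<Longrightarrow> b \<in> A' \<Longrightarrow> a \<cdot> b = Some c \<Longrightarrow> c \<in> A'"

section \<open>The relative realizability topos\<close>

record ('x, 'a) rt_obj =
  carr :: "'x set"
  eqv :: "'x \<Rightarrow> 'x \<Rightarrow> 'a set"

context elementary_subpca
begin

text \<open>Truth values are arbitrary subsets of the algebra, but validity requires a realizer in the
  subalgebra. Universal and existential quantification are intersection and union.\<close>

definition valid :: "'a set \<Rightarrow> bool" where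
  "valid p \<longleftrightarrow> p \<inter> A' \<noteq> {}"

text \<open>The symmetry and transitivity that make \<open>X\<close> an object of the topos. All morphisms below are
  between \<open>rt_one\<close>, \<open>Omega\<close> and their products, which satisfy this.\<close>

definition rt_object :: "('x, 'a) rt_obj \<Rightarrow> bool" where
  "rt_object X \<longleftrightarrow>
     valid (\<Inter>x\<in>carr X. \<Inter>y\<in>carr X. eqv X x y \<rightharpoonup> eqv X y x) \<and>
     valid (\<Inter>x\<in>carr X. \<Inter>y\<in>carr X. \<Inter>z\<in>carr X. eqv X x y \<sqinter> eqv X y z \<rightharpoonup> eqv X x z)"

text \<open>Strict, relational, single-valued and total.\<close>

definition functional_rel ::
  "('x, 'a) rt_obj \<Rightarrow> ('y, 'a) rt_obj \<Rightarrow> ('x \<Rightarrow> 'y \<Rightarrow> 'a set) \<Rightarrow> bool" where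
  "functional_rel X Y F \<longleftrightarrow>
     valid (\<Inter>x\<in>carr X. \<Inter>y\<in>carr Y. F x y \<rightharpoonup> eqv X x x \<sqinter> eqv Y y y) \<and>
     valid (\<Inter>x\<in>carr X. \<Inter>x'\<in>carr X. \<Inter>y\<in>carr Y. \<Inter>y'\<in>carr Y.
              F x y \<sqinter> eqv X x x' \<sqinter> eqv Y y y' \<rightharpoonup> F x' y') \<and>
     valid (\<Inter>x\<in>carr X. \<Inter>y\<in>carr Y. \<Inter>y'\<in>carr Y. F x y \<sqinter> F x y' \<rightharpoonup> eqv Y y y') \<and>
     valid (\<Inter>x\<in>carr X. eqv X x x \<rightharpoonup> (\<Union>y\<in>carr Y. F x y))"

definition rel_equiv ::
  "('x, 'a) rt_obj \<Rightarrow> ('y, 'a) rt_obj \<Rightarrow> ('x \<Rightarrow> 'y \<Rightarrow> 'a set) \<Rightarrow> ('x \<Rightarrow> 'y \<Rightarrow> 'a set) \<Rightarrow> bool" where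
  "rel_equiv X Y F G \<longleftrightarrow> valid (\<Inter>x\<in>carr X. \<Inter>y\<in>carr Y. F x y \<rightleftharpoons> G x y)"

definition rt_class ::
  "('x, 'a) rt_obj \<Rightarrow> ('y, 'a) rt_obj \<Rightarrow> ('x \<Rightarrow> 'y \<Rightarrow> 'a set) \<Rightarrow> ('x \<Rightarrow> 'y \<Rightarrow> 'a set) set" where
  "rt_class X Y F = {G. functional_rel X Y G \<and> rel_equiv X Y G F}"

text \<open>Morphisms are equivalence classes of functional relations.\<close>

definition rt_hom ::
  "('x, 'a) rt_obj \<Rightarrow> ('y, 'a) rt_obj \<Rightarrow> ('x \<Rightarrow> 'y \<Rightarrow> 'a set) set set" where
  "rt_hom X Y = {rt_class X Y F |F. functional_rel X Y F}"

definition rt_comp ::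
  "('x, 'a) rt_obj \<Rightarrow> ('y, 'a) rt_obj \<Rightarrow> ('z, 'a) rt_obj \<Rightarrow>
   ('y \<Rightarrow> 'z \<Rightarrow> 'a set) set \<Rightarrow> ('x \<Rightarrow> 'y \<Rightarrow> 'a set) set \<Rightarrow> ('x \<Rightarrow> 'z \<Rightarrow> 'a set) set" where
  "rt_comp X Y Z g f =
     (\<Union>F\<in>f. \<Union>G\<in>g. rt_class X Z (\<lambda>x z. \<Union>y\<in>carr Y. F x y \<sqinter> G y z))"

definition rt_prod :: "('x, 'a) rt_obj \<Rightarrow> ('y, 'a) rt_obj \<Rightarrow> ('x \<times> 'y, 'a) rt_obj" where
  "rt_prod X Y = \<lparr>carr = carr X \<times> carr Y,
                  eqv = (\<lambda>(x, y) (x', y'). eqv X x x' \<sqinter> eqv Y y y')\<rparr>"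

definition rt_prod_map ::
  "('x, 'a) rt_obj \<Rightarrow> ('y, 'a) rt_obj \<Rightarrow> ('u, 'a) rt_obj \<Rightarrow> ('v, 'a) rt_obj \<Rightarrow>
   ('x \<Rightarrow> 'u \<Rightarrow> 'a set) set \<Rightarrow> ('y \<Rightarrow> 'v \<Rightarrow> 'a set) set \<Rightarrow> ('x \<times> 'y \<Rightarrow> 'u \<times> 'v \<Rightarrow> 'a set) set" where
  "rt_prod_map X Y U V f g =
     (\<Union>F\<in>f. \<Union>G\<in>g. rt_class (rt_prod X Y) (rt_prod U V)
        (\<lambda>(x, y) (u, v). F x u \<sqinter> G y v))"

definition rt_one :: "(unit, 'a) rt_obj" where
  "rt_one = \<lparr>carr = UNIV, eqv = (\<lambda>_ _. UNIV)\<rparr>"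

definition Omega :: "('a set, 'a) rt_obj" where
  "Omega = \<lparr>carr = UNIV, eqv = tv_iff\<rparr>"

text \<open>The relation of the morphism into \<open>Omega\<close> given by an extensional map into truth values. The
  conjunct \<open>eqv X x x\<close> usually needed for strictness is left out: on the domains used here
  (\<open>rt_one\<close>, \<open>Omega\<close> and their products) it is realized by one fixed element of the subalgebra.\<close>

definition to_Omega :: "('x \<Rightarrow> 'a set) \<Rightarrow> 'x \<Rightarrow> 'a set \<Rightarrow> 'a set" where
  "to_Omega \<phi> x q = (\<phi> x \<rightleftharpoons> q)"

definition rt_true :: "(unit \<Rightarrow> 'a set \<Rightarrow> 'a set) set" where
  "rt_true = rt_class rt_one Omega (to_Omega (\<lambda>_. UNIV))"

definition rt_meet :: "('a set \<times> 'a set \<Rightarrow> 'a set \<Rightarrow> 'a set) set" where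
  "rt_meet = rt_class (rt_prod Omega Omega) Omega (to_Omega (\<lambda>(p, q). p \<sqinter> q))"

definition lawvere_tierney :: "('a set \<Rightarrow> 'a set \<Rightarrow> 'a set) set \<Rightarrow> bool" where
  "lawvere_tierney j \<longleftrightarrow>
     j \<in> rt_hom Omega Omega \<and>
     rt_comp rt_one Omega Omega j rt_true = rt_true \<and>
     rt_comp Omega Omega Omega j j = j \<and>
     rt_comp (rt_prod Omega Omega) Omega Omega j rt_meet =
     rt_comp (rt_prod Omega Omega) (rt_prod Omega Omega) Omega
       rt_meet (rt_prod_map Omega Omega Omega Omega j j)"

text \<open>Since \<open>j\<close> is an equivalence class, membership says that \<open>j\<close> is the class of the functional
  relation of \<open>J\<close>.\<close>

definition represented_by :: "('a set \<Rightarrow> 'a set \<Rightarrow> 'a set) set \<Rightarrow> ('a set \<Rightarrow> 'a set) \<Rightarrow> bool" where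
  "represented_by j J \<longleftrightarrow> to_Omega J \<in> j"

end

end

(* Choosing a functional relation F in j, the map J p = (UN q. F p q & q) (& being conjunction of truth values) represents j, and the
   axioms for j make J a monad on truth values, uniformly in realizers. Let f b consist of the sets T
   with b in J T. Asking b and returning the answer gives J S --> O_f S; conversely, O_f S --> J S by
   recursion over the dialogue, with the unit of J at its leaves and the bind of J at its questions. *)

theory Submission
  imports Defs
begin

section \<open>Combinatory completeness\<close>

text \<open>The axioms on \<open>j\<close> are equalities of equivalence classes, whereas dialogues
  consume realizers. The bridge: two maps naming the same morphism are equivalent by one realizer in
  \<open>A'\<close> valid for all truth values, so each equation turns into an entailment between
  families and the rest is deduction in the realizability logic. Monotonicity of \<open>J\<close> is
  needed in internal form, with the implication as a hypothesis of the entailment, because the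
  continuation of a dialogue is data and in general not an element of \<open>A'\<close>. A realizer
  that meets a question sees \<open>b\<close> but not the set \<open>T\<close> with
  \<open>b \<in> J T\<close> from which the answer comes. One \<open>b\<close> may belong to
  \<open>J T\<close> for many \<open>T\<close>; this is why \<open>f b\<close> is a set of sets, and
  why the bind realizer must not depend on \<open>T\<close>. The recursion is a fixed point that may
  be undefined on arbitrary arguments; that it is defined on dialogues follows from their inductive
  generation.\<close>

datatype 'a trm = V nat | C 'a | App "'a trm" "'a trm" (infixl "\<bullet>" 70)

context pca
begin

primrec eval :: "(nat \<Rightarrow> 'a) \<Rightarrow> 'a trm \<Rightarrow> 'a option" where
  "eval e (V n) = Some (e n)"
| "eval e (C a) = Some a"
| "eval e (t \<bullet> u) = kleene_app app (eval e t) (eval e u)"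

text \<open>The abstraction is pushed down to the leaves even where \<open>V n\<close> does not
  occur: \<open>k\<close> applied to an undefined compound term is undefined, while this form always
  has a value.\<close>

primrec lam :: "nat \<Rightarrow> 'a trm \<Rightarrow> 'a trm" where
  "lam n (V m) = (if m = n then C idc else C k \<bullet> V m)"
| "lam n (C a) = C k \<bullet> C a"
| "lam n (t \<bullet> u) = C s \<bullet> lam n t \<bullet> lam n u"

text \<open>This covers undefined \<open>t\<close> as well: \<open>s\<close> applied to two values
  is always defined, and its third argument is distributed up to Kleene equality.\<close>

lemma eval_lam_ex: "\<exists>v. eval e (lam n t) = Some v \<and> (\<forall>a. v \<cdot> a = eval (e(n := a)) t)"
  by (induction t) (auto simp: kleene_app_def k_ap s_ap idc_app)

text \<open>Abstractions always have a value, so \<open>the\<close> is safe. With a name for that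
  value, nested abstractions evaluate one application at a time.\<close>

definition closure :: "(nat \<Rightarrow> 'a) \<Rightarrow> nat \<Rightarrow> 'a trm \<Rightarrow> 'a" where
  "closure e n t = the (eval e (lam n t))"

lemma eval_lam [simp]: "eval e (lam n t) = Some (closure e n t)"
  and closure_app [simp]: "closure e n t \<cdot> a = eval (e(n := a)) t"
  using eval_lam_ex[of e n t] by (auto simp: closure_def)

lemma kleene_app_Some [simp]:
  "kleene_app app (Some a) (Some b) = a \<cdot> b"
  by (simp add: kleene_app_def)

definition pair_trm :: "'a trm \<Rightarrow> 'a trm \<Rightarrow> 'a trm" where
  "pair_trm t u = C s \<bullet> (C s \<bullet> C idc \<bullet> (C k \<bullet> t)) \<bullet> (C k \<bullet> u)"

definition fst_trm :: "'a trm \<Rightarrow> 'a trm" where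
  "fst_trm t = t \<bullet> C k"

definition snd_trm :: "'a trm \<Rightarrow> 'a trm" where
  "snd_trm t = t \<bullet> C (ap k idc)"

lemma pair_fst [simp]: "pair a b \<cdot> k = Some a"
  and pair_snd [simp]: "pair a b \<cdot> ap k idc = Some b"
  by (simp_all add: pair_app k_ap idc_app)

lemma eval_pair_trm [simp]:
  "eval e (pair_trm t u) =
     Option.bind (eval e t) (\<lambda>a. Option.bind (eval e u) (\<lambda>b. Some (pair a b)))"
  by (simp add: pair_trm_def pair_def k_ap s_ap kleene_app_def split: Option.bind_split)

lemma eval_fst_trm [simp]: "eval e (fst_trm t) = kleene_app app (eval e t) (Some k)"
  by (simp add: fst_trm_def)

lemma eval_snd_trm [simp]: "eval e (snd_trm t) = kleene_app app (eval e t) (Some (ap k idc))"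
  by (simp add: snd_trm_def)

end

section \<open>Realizers in the subalgebra\<close>

context elementary_subpca
begin

lemma kleene_app_sub:
  assumes "\<And>a. t = Some a \<Longrightarrow> a \<in> A'" "\<And>b. u = Some b \<Longrightarrow> b \<in> A'" "kleene_app app t u = Some c"
  shows "c \<in> A'"
proof -
  obtain a b where "t = Some a" "u = Some b" "a \<cdot> b = Some c"
    using assms(3) by (cases t; cases u) (simp_all add: kleene_app_def)
  with assms(1,2) show ?thesis
    by (blast intro: app_sub)
qed

lemma ap_k_sub: "a \<in> A' \<Longrightarrow> ap k a \<in> A'"
  and ap_ap_s_sub: "a \<in> A' \<Longrightarrow> b \<in> A' \<Longrightarrow> ap (ap s a) b \<in> A'"
  by (blast intro: app_sub[OF k_sub _ k_ap(1)] app_sub[OF app_sub[OF s_sub _ s_ap(1)] _ s_ap(2)])+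

lemma idc_sub: "idc \<in> A'"
  by (simp add: idc_def ap_ap_s_sub k_sub)

lemma pair_sub: "a \<in> A' \<Longrightarrow> b \<in> A' \<Longrightarrow> pair a b \<in> A'"
  by (simp add: pair_def ap_ap_s_sub ap_k_sub idc_sub)

lemma num_sub: "num n \<in> A'"
  by (induction n) (auto simp: idc_sub pair_sub ap_k_sub k_sub)

lemma eval_sub:
  "eval e t = Some v \<Longrightarrow> set_trm t \<subseteq> A' \<Longrightarrow> range e \<subseteq> A' \<Longrightarrow> v \<in> A'"
proof (induction t arbitrary: v)
  case (App t u)
  from App.prems have "kleene_app app (eval e t) (eval e u) = Some v"
    by simp
  moreover have "a \<in> A'" if "eval e t = Some a" for a
    using App.IH(1)[OF that] App.prems(2,3) by simp
  moreover have "b \<in> A'" if "eval e u = Some b" for b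
    using App.IH(2)[OF that] App.prems(2,3) by simp
  ultimately show ?case
    by (metis kleene_app_sub)
qed auto

lemma set_lam: "set_trm (lam n t) \<subseteq> set_trm t \<union> A'"
  by (induction t) (auto simp: idc_sub k_sub s_sub)

text \<open>Abstractions stay folded from here on, so that evaluation goes through
  \<open>closure_app\<close> and not through combinator code.\<close>

declare lam.simps [simp del]

lemma closure_sub:
  assumes "set_trm t \<subseteq> A'" "range e \<subseteq> A'"
  shows "closure e n t \<in> A'"
  using eval_sub[OF eval_lam[of e n t]] set_lam[of n t] assms by blast

lemma set_derived_trms:
  "set_trm t \<subseteq> A' \<Longrightarrow> set_trm u \<subseteq> A' \<Longrightarrow> set_trm (pair_trm t u) \<subseteq> A'"
  "set_trm t \<subseteq> A' \<Longrightarrow> set_trm (fst_trm t) \<subseteq> A'"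
  "set_trm t \<subseteq> A' \<Longrightarrow> set_trm (snd_trm t) \<subseteq> A'"
  "set_trm t \<subseteq> A' \<Longrightarrow> set_trm (lam n t) \<subseteq> A'"
  using set_lam[of n t]
  by (auto simp: pair_trm_def fst_trm_def snd_trm_def k_sub s_sub idc_sub ap_k_sub)

text \<open>Variable 0 is the input. All other variables hold \<open>k\<close>, an arbitrary element
  of \<open>A'\<close>, as \<open>closure_sub\<close> wants the whole environment in the
  subalgebra.\<close>

lemma realizer_ex:
  assumes "set_trm t \<subseteq> A'"
  shows "\<exists>r\<in>A'. \<forall>a. r \<cdot> a = eval ((\<lambda>_. k)(0 := a)) t"
  using closure_sub[OF assms, of "\<lambda>_. k" 0] k_sub by (auto intro!: bexI)

text \<open>Application to \<open>k\<close> is a zero test: \<open>num 0\<close> is the identity and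
  yields \<open>k\<close>, a successor is a pair and yields its first component, false. The result
  then selects one of two further arguments.\<close>

lemma num_0_case: "num 0 \<cdot> k = Some k"
  and num_1_case: "num (Suc n) \<cdot> k = Some (ap k idc)"
  by (simp_all add: idc_app pair_app k_ap)

text \<open>The recursion is the call-by-value fixed point \<open>w w\<close> of \<open>w = \<lambda>x d. \<dots> (x x) \<dots>\<close>. The body
  first selects a branch by the numeral tag and only then applies it, so that the unselected branch
  is never run.\<close>

lemma recursor_ex:
  assumes e: "e \<in> A'" and h: "h \<in> A'"
  shows "\<exists>r\<in>A'. (\<forall>a. r \<cdot> pair (num 0) a = e \<cdot> a) \<and>
           (\<forall>b c. \<exists>v. (\<forall>d. v \<cdot> d = kleene_app app (Some r) (c \<cdot> d)) \<and>
                      r \<cdot> pair (num 1) (pair b c) = h \<cdot> pair b v)"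
proof -
  \<comment> \<open>Variable 0 holds \<open>w\<close>, so \<open>V 0 \<bullet> V 0\<close> is the
    recursor; 1 holds the dialogue, 2 its payload \<open>pair b c\<close>, 3 an answer
    \<open>d\<close>. Abstracting over \<open>d\<close> delays the recursive call until an answer
    arrives.\<close>
  define rec where "rec = lam 3 (V 0 \<bullet> V 0 \<bullet> (snd_trm (V 2) \<bullet> V 3))"
  define step where "step = lam 2 (C h \<bullet> pair_trm (fst_trm (V 2)) rec)"
  define body where "body = fst_trm (V 1) \<bullet> C k \<bullet> C e \<bullet> step \<bullet> snd_trm (V 1)"
  define w where "w = closure (\<lambda>_. k) 0 (lam 1 body)"
  define r where "r = closure ((\<lambda>_. k)(0 := w)) 1 body"
  have body_sub: "set_trm body \<subseteq> A'"
    using e h k_sub unfolding body_def step_def rec_def by (simp add: set_derived_trms)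
  have w_sub: "w \<in> A'"
    unfolding w_def using body_sub k_sub by (intro closure_sub) (auto simp: set_derived_trms)
  have r_sub: "r \<in> A'"
    unfolding r_def using body_sub w_sub k_sub by (intro closure_sub) auto
  have ww: "w \<cdot> w = Some r"
    by (simp add: w_def r_def)
  have r_app: "r \<cdot> d = eval ((\<lambda>_. k)(0 := w, 1 := d)) body" for d
    by (simp add: r_def)
  have ret: "r \<cdot> pair (num 0) a = e \<cdot> a" for a
  proof -
    let ?e = "(\<lambda>_. k)(0 := w, 1 := pair (num 0) a)"
    have "eval ?e step = Some (closure ?e 2 (C h \<bullet> pair_trm (fst_trm (V 2)) rec))"
      by (simp add: step_def)
    moreover have "eval ?e (fst_trm (V 1)) = Some (num 0)" "eval ?e (snd_trm (V 1)) = Some a"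
      by (simp_all del: num.simps)
    ultimately show ?thesis
      by (simp add: r_app body_def num_0_case k_ap del: num.simps)
  qed
  have ask: "\<exists>v. (\<forall>d. v \<cdot> d = kleene_app app (Some r) (c \<cdot> d)) \<and>
              r \<cdot> pair (num 1) (pair b c) = h \<cdot> pair b v" for b c
  proof -
    let ?e = "(\<lambda>_. k)(0 := w, 1 := pair (num 1) (pair b c))"
    let ?e2 = "?e(2 := pair b c)"
    define v where "v = closure ?e2 3 (V 0 \<bullet> V 0 \<bullet> (snd_trm (V 2) \<bullet> V 3))"
    have "v \<cdot> d = kleene_app app (Some r) (c \<cdot> d)" for d
      by (simp add: v_def ww)
    moreover have "r \<cdot> pair (num 1) (pair b c) = h \<cdot> pair b v"
    proof -
      have "eval ?e step = Some (closure ?e 2 (C h \<bullet> pair_trm (fst_trm (V 2)) rec))"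
        by (simp add: step_def)
      moreover have "eval ?e (fst_trm (V 1)) = Some (num 1)"
        "eval ?e (snd_trm (V 1)) = Some (pair b c)"
        by (simp_all del: num.simps)
      moreover have "eval ?e2 (pair_trm (fst_trm (V 2)) rec) = Some (pair b v)"
        by (simp add: rec_def v_def)
      ultimately show ?thesis
        by (simp add: r_app body_def num_1_case k_ap idc_app del: num.simps)
    qed
    ultimately show ?thesis
      by blast
  qed
  show ?thesis
    using r_sub ret ask by blast
qed

section \<open>Uniform entailment between families of truth values\<close>

text \<open>The order of the fibre over \<open>'i\<close> in the relative realizability tripos. The
  indices play the role of free variables, so substitution is reindexing.\<close>

definition entails :: "('i \<Rightarrow> 'a set) \<Rightarrow> ('i \<Rightarrow> 'a set) \<Rightarrow> bool"  (infix "\<turnstile>" 50) where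
  "p \<turnstile> q \<longleftrightarrow> (\<exists>r\<in>A'. \<forall>i. r \<in> p i \<rightharpoonup> q i)"

lemma entailsI:
  assumes "set_trm t \<subseteq> A'"
    and "\<And>i a. a \<in> p i \<Longrightarrow> \<exists>b. eval ((\<lambda>_. k)(0 := a)) t = Some b \<and> b \<in> q i"
  shows "p \<turnstile> q"
proof -
  obtain r where "r \<in> A'" "\<And>a. r \<cdot> a = eval ((\<lambda>_. k)(0 := a)) t"
    using realizer_ex[OF assms(1)] by blast
  then show ?thesis
    using assms(2) unfolding entails_def tv_imp_def by (intro bexI[of _ r]) auto
qed

lemma entailsE:
  assumes "p \<turnstile> q"
  obtains r where "r \<in> A'" "\<And>i a. a \<in> p i \<Longrightarrow> \<exists>b. r \<cdot> a = Some b \<and> b \<in> q i"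
  using assms by (auto simp: entails_def tv_imp_def)

lemma ent_refl: "p \<turnstile> p"
  by (rule entailsI[of "V 0"]) auto

lemma ent_trans:
  assumes "p \<turnstile> q" "q \<turnstile> u"
  shows "p \<turnstile> u"
proof -
  obtain r r' where r: "r \<in> A'" "r' \<in> A'"
    "\<And>i a. a \<in> p i \<Longrightarrow> \<exists>b. r \<cdot> a = Some b \<and> b \<in> q i"
    "\<And>i a. a \<in> q i \<Longrightarrow> \<exists>b. r' \<cdot> a = Some b \<and> b \<in> u i"
    using assms by (metis entailsE)
  show ?thesis
  proof (rule entailsI[of "C r' \<bullet> (C r \<bullet> V 0)"])
    fix i a assume "a \<in> p i"
    then obtain b b' where "r \<cdot> a = Some b" "r' \<cdot> b = Some b'" "b' \<in> u i"
      using r by meson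
    then show "\<exists>b. eval ((\<lambda>_. k)(0 := a)) (C r' \<bullet> (C r \<bullet> V 0)) = Some b \<and> b \<in> u i"
      by simp
  qed (use r(1,2) in simp)
qed

lemma ent_reindex: "p \<turnstile> q \<Longrightarrow> (\<lambda>i. p (g i)) \<turnstile> (\<lambda>i. q (g i))"
  by (auto simp: entails_def)

lemma conj_fst: "(\<lambda>i. p i \<sqinter> q i) \<turnstile> p"
  by (rule entailsI[of "fst_trm (V 0)"]) (auto simp: set_derived_trms tv_conj_def)

lemma conj_snd: "(\<lambda>i. p i \<sqinter> q i) \<turnstile> q"
  by (rule entailsI[of "snd_trm (V 0)"]) (auto simp: set_derived_trms tv_conj_def)

lemmas ent_conjD1 = ent_trans[OF _ conj_fst]
lemmas ent_conjD2 = ent_trans[OF _ conj_snd]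

lemma ent_conjI:
  assumes "H \<turnstile> p" "H \<turnstile> q"
  shows "H \<turnstile> (\<lambda>i. p i \<sqinter> q i)"
proof -
  obtain r r' where r: "r \<in> A'" "r' \<in> A'"
    "\<And>i a. a \<in> H i \<Longrightarrow> \<exists>b. r \<cdot> a = Some b \<and> b \<in> p i"
    "\<And>i a. a \<in> H i \<Longrightarrow> \<exists>b. r' \<cdot> a = Some b \<and> b \<in> q i"
    using assms by (metis entailsE)
  show ?thesis
  proof (rule entailsI[of "pair_trm (C r \<bullet> V 0) (C r' \<bullet> V 0)"])
    fix i a assume "a \<in> H i"
    then obtain b b' where "r \<cdot> a = Some b" "b \<in> p i" "r' \<cdot> a = Some b'" "b' \<in> q i"
      using r by meson
    then show "\<exists>b. eval ((\<lambda>_. k)(0 := a)) (pair_trm (C r \<bullet> V 0) (C r' \<bullet> V 0)) = Some b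
                 \<and> b \<in> p i \<sqinter> q i"
      by (auto simp: tv_conj_def)
  qed (use r(1,2) in \<open>auto simp: set_derived_trms\<close>)
qed

lemma ent_weaken: "H \<turnstile> q \<Longrightarrow> (\<lambda>i. H i \<sqinter> p i) \<turnstile> q"
  by (rule ent_trans[OF conj_fst])

lemma ent_impI:
  assumes "(\<lambda>i. H i \<sqinter> p i) \<turnstile> q"
  shows "H \<turnstile> (\<lambda>i. p i \<rightharpoonup> q i)"
proof -
  obtain r where r: "r \<in> A'" "\<And>i a. a \<in> H i \<sqinter> p i \<Longrightarrow> \<exists>b. r \<cdot> a = Some b \<and> b \<in> q i"
    using entailsE[OF assms] by blast
  show ?thesis
  proof (rule entailsI[of "lam 1 (C r \<bullet> pair_trm (V 0) (V 1))"])
    fix i a assume "a \<in> H i"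
    then show "\<exists>b. eval ((\<lambda>_. k)(0 := a)) (lam 1 (C r \<bullet> pair_trm (V 0) (V 1))) = Some b
                 \<and> b \<in> p i \<rightharpoonup> q i"
      using r(2)[of "pair a _" i] by (auto simp: tv_conj_def tv_imp_def)
  qed (use r(1) in \<open>auto simp: set_derived_trms\<close>)
qed

lemma ent_mp:
  assumes "H \<turnstile> (\<lambda>i. p i \<rightharpoonup> q i)" "H \<turnstile> p"
  shows "H \<turnstile> q"
proof (rule ent_trans[OF ent_conjI[OF assms]])
  show "(\<lambda>i. (p i \<rightharpoonup> q i) \<sqinter> p i) \<turnstile> q"
    by (rule entailsI[of "fst_trm (V 0) \<bullet> snd_trm (V 0)"])
      (auto simp: set_derived_trms tv_conj_def tv_imp_def)
qed

lemma ent_iffI: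
  "(\<lambda>i. H i \<sqinter> p i) \<turnstile> q \<Longrightarrow> (\<lambda>i. H i \<sqinter> q i) \<turnstile> p \<Longrightarrow> H \<turnstile> (\<lambda>i. p i \<rightleftharpoons> q i)"
  unfolding tv_iff_def by (intro ent_conjI ent_impI)

lemma ent_iffD1: "H \<turnstile> (\<lambda>i. p i \<rightleftharpoons> q i) \<Longrightarrow> H \<turnstile> p \<Longrightarrow> H \<turnstile> q"
  and ent_iffD2: "H \<turnstile> (\<lambda>i. p i \<rightleftharpoons> q i) \<Longrightarrow> H \<turnstile> q \<Longrightarrow> H \<turnstile> p"
  unfolding tv_iff_def by (rule ent_mp[OF ent_conjD1] ent_mp[OF ent_conjD2]; assumption)+

lemma ent_iffI_closed: "p \<turnstile> q \<Longrightarrow> q \<turnstile> p \<Longrightarrow> H \<turnstile> (\<lambda>i. p i \<rightleftharpoons> q i)"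
  by (rule ent_iffI; rule ent_trans[OF conj_snd])

lemma ent_impI_closed: "p \<turnstile> q \<Longrightarrow> H \<turnstile> (\<lambda>i. p i \<rightharpoonup> q i)"
  by (rule ent_impI, rule ent_trans[OF conj_snd])

text \<open>A union carries no realizer of its witness, so \<open>y\<close> may depend on the index
  in any way.\<close>

lemma ent_UnI: "H \<turnstile> (\<lambda>i. p i (y i)) \<Longrightarrow> H \<turnstile> (\<lambda>i. \<Union>y. p i y)"
  by (fastforce simp: entails_def tv_imp_def)

text \<open>The bound variable becomes a second component of the index. Only the two projections are
  used as \<open>x\<close> and \<open>y\<close>; leaving them arbitrary in the premise keeps
  \<open>fst\<close> and \<open>snd\<close> out of later goals.\<close>

lemma ent_UnE_left:
  assumes "\<And>x y. (\<lambda>i :: 'i \<times> 'y. p (x i) (y i)) \<turnstile> (\<lambda>i. q (x i))"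
  shows "(\<lambda>i :: 'i. \<Union>y :: 'y. p i y) \<turnstile> q"
  using assms[of fst snd] by (fastforce simp: entails_def tv_imp_def)

lemma ent_UnE:
  assumes "H \<turnstile> (\<lambda>i :: 'i. \<Union>y :: 'y. p i y)"
    and "\<And>x y. (\<lambda>i :: 'i \<times> 'y. H (x i) \<sqinter> p (x i) (y i)) \<turnstile> (\<lambda>i. q (x i))"
  shows "H \<turnstile> q"
proof (rule ent_trans[OF ent_conjI[OF ent_refl assms(1)]])
  have "(\<lambda>i. H i \<sqinter> (\<Union>y. p i y)) = (\<lambda>i. \<Union>y. H i \<sqinter> p i y)"
    by (fastforce simp: tv_conj_def)
  then show "(\<lambda>i. H i \<sqinter> (\<Union>y. p i y)) \<turnstile> q"
    using ent_UnE_left[of "\<lambda>i y. H i \<sqinter> p i y" q] assms(2) by simp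
qed

section \<open>Validity of quantified formulas as entailment from truth\<close>

text \<open>From right to left the realizer is applied to some element of \<open>A'\<close>, here
  \<open>k\<close>. The result is in \<open>A'\<close> and is the same for all indices, hence lies
  in the intersection.\<close>

lemma valid_iff_ent: "valid (\<Inter>x. q x) \<longleftrightarrow> (\<lambda>_. UNIV) \<turnstile> q"
proof
  assume "valid (\<Inter>x. q x)"
  then obtain r where "r \<in> A'" "\<And>x. r \<in> q x"
    by (auto simp: valid_def)
  then show "(\<lambda>_. UNIV) \<turnstile> q"
    by (intro entailsI[of "C r"]) auto
next
  assume "(\<lambda>_. UNIV) \<turnstile> q"
  then obtain r where r: "r \<in> A'"
    "\<And>i a. \<exists>b. r \<cdot> a = Some b \<and> b \<in> q i"
    by (auto simp: entails_def tv_imp_def)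
  obtain b where b: "r \<cdot> k = Some b"
    using r(2)[of k] by auto
  then have "b \<in> q i" for i
    using r(2)[of k i] by simp
  moreover have "b \<in> A'"
    by (rule app_sub[OF r(1) k_sub b])
  ultimately show "valid (\<Inter>x. q x)"
    unfolding valid_def by blast
qed

lemma ent_UNIV: "H \<turnstile> (\<lambda>_. UNIV)"
  by (rule entailsI[of "V 0"]) auto

lemma validD: "valid (\<Inter>x. q x) \<Longrightarrow> H \<turnstile> (\<lambda>i. q (x i))"
  unfolding valid_iff_ent by (rule ent_trans[OF ent_UNIV]) (rule ent_reindex[of "\<lambda>_. UNIV"])

lemma valid_pairs: "valid (\<Inter>x. \<Inter>y. q x y) \<longleftrightarrow> valid (\<Inter>z. q (fst z) (snd z))"
proof -
  have "(\<Inter>x. \<Inter>y. q x y) = (\<Inter>z. q (fst z) (snd z))"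
    by auto
  then show ?thesis
    by simp
qed

lemma validI1: "(\<lambda>_. UNIV) \<turnstile> q \<Longrightarrow> valid (\<Inter>x. q x)"
  by (simp add: valid_iff_ent)

lemma validI2:
  assumes "\<And>x y. (\<lambda>_ :: 'x \<times> 'y. UNIV) \<turnstile> (\<lambda>i. q (x i) (y i))"
  shows "valid (\<Inter>x :: 'x. \<Inter>y :: 'y. q x y)"
  unfolding valid_pairs valid_iff_ent by (rule assms)

lemma validD2: "valid (\<Inter>x. \<Inter>y. q x y) \<Longrightarrow> H \<turnstile> (\<lambda>i. q (x i) (y i))"
  unfolding valid_pairs using validD[of "\<lambda>z. q (fst z) (snd z)" H "\<lambda>i. (x i, y i)"] by simp

lemma validI3:
  assumes "\<And>x y z. (\<lambda>_ :: ('x \<times> 'y) \<times> 'z. UNIV) \<turnstile> (\<lambda>i. q (x i) (y i) (z i))"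
  shows "valid (\<Inter>x :: 'x. \<Inter>y :: 'y. \<Inter>z :: 'z. q x y z)"
  unfolding valid_pairs valid_iff_ent by (rule assms)

lemma validD3: "valid (\<Inter>x. \<Inter>y. \<Inter>z. q x y z) \<Longrightarrow> H \<turnstile> (\<lambda>i. q (x i) (y i) (z i))"
  unfolding valid_pairs[of "\<lambda>x y. \<Inter>z. q x y z"]
  using validD2[of "\<lambda>u z. q (fst u) (snd u) z" H "\<lambda>i. (x i, y i)" z] by simp

lemma validI4:
  assumes "\<And>x y z u. (\<lambda>_ :: (('x \<times> 'y) \<times> 'z) \<times> 'u. UNIV) \<turnstile> (\<lambda>i. q (x i) (y i) (z i) (u i))"
  shows "valid (\<Inter>x :: 'x. \<Inter>y :: 'y. \<Inter>z :: 'z. \<Inter>u :: 'u. q x y z u)"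
  unfolding valid_pairs valid_iff_ent by (rule assms)

lemma validD4:
  "valid (\<Inter>x. \<Inter>y. \<Inter>z. \<Inter>u. q x y z u) \<Longrightarrow> H \<turnstile> (\<lambda>i. q (x i) (y i) (z i) (u i))"
  unfolding valid_pairs[of "\<lambda>x y. \<Inter>z. \<Inter>u. q x y z u"]
  using validD3[of "\<lambda>v z u. q (fst v) (snd v) z u" H "\<lambda>i. (x i, y i)" z u] by simp

section \<open>Graphs of extensional maps\<close>

text \<open>Since existence is trivially realized on these objects, the graph of an extensional map is
  strict without an extra conjunct.\<close>

definition unif_obj :: "('x, 'a) rt_obj \<Rightarrow> bool" where
  "unif_obj X \<longleftrightarrow> carr X = UNIV \<and> valid (\<Inter>x. eqv X x x) \<and>
     valid (\<Inter>x. \<Inter>y. eqv X x y \<rightharpoonup> eqv X y x) \<and>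
     valid (\<Inter>x. \<Inter>y. \<Inter>z. eqv X x y \<sqinter> eqv X y z \<rightharpoonup> eqv X x z)"

lemma unif_refl: "unif_obj X \<Longrightarrow> H \<turnstile> (\<lambda>i. eqv X (x i) (x i))"
  unfolding unif_obj_def by (rule validD[of "\<lambda>x. eqv X x x"]) simp

lemma unif_sym:
  assumes "unif_obj X" "H \<turnstile> (\<lambda>i. eqv X (x i) (y i))"
  shows "H \<turnstile> (\<lambda>i. eqv X (y i) (x i))"
proof -
  have "valid (\<Inter>x. \<Inter>y. eqv X x y \<rightharpoonup> eqv X y x)"
    using assms(1) by (simp add: unif_obj_def)
  from ent_mp[OF validD2[OF this] assms(2)] show ?thesis .
qed

lemma unif_trans:
  assumes "unif_obj X" "H \<turnstile> (\<lambda>i. eqv X (x i) (y i))" "H \<turnstile> (\<lambda>i. eqv X (y i) (z i))"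
  shows "H \<turnstile> (\<lambda>i. eqv X (x i) (z i))"
proof -
  have "valid (\<Inter>x. \<Inter>y. \<Inter>z. eqv X x y \<sqinter> eqv X y z \<rightharpoonup> eqv X x z)"
    using assms(1) by (simp add: unif_obj_def)
  from ent_mp[OF validD3[OF this] ent_conjI[OF assms(2,3)]] show ?thesis .
qed

lemma unif_objI:
  assumes "carr X = UNIV"
    and "\<And>x. (\<lambda>i :: 'x. UNIV) \<turnstile> (\<lambda>i. eqv X (x i) (x i))"
    and "\<And>x y. (\<lambda>i :: 'x \<times> 'x. eqv X (x i) (y i)) \<turnstile> (\<lambda>i. eqv X (y i) (x i))"
    and "\<And>x y z. (\<lambda>i :: ('x \<times> 'x) \<times> 'x. eqv X (x i) (y i) \<sqinter> eqv X (y i) (z i))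
            \<turnstile> (\<lambda>i. eqv X (x i) (z i))"
  shows "unif_obj (X :: ('x, 'a) rt_obj)"
  unfolding unif_obj_def assms(1)
  by (intro conjI validI1 validI2 validI3 ent_impI_closed assms refl)

lemma unif_one: "unif_obj rt_one"
  by (rule unif_objI) (simp_all add: rt_one_def ent_UNIV)

lemma unif_Omega: "unif_obj Omega"
proof (rule unif_objI; (simp only: Omega_def rt_obj.simps)?)
  fix x y z :: "'i \<Rightarrow> 'a set"
  show "H \<turnstile> (\<lambda>i. x i \<rightleftharpoons> x i)" for H
    by (intro ent_iffI_closed ent_refl)
  show "(\<lambda>i. x i \<rightleftharpoons> y i) \<turnstile> (\<lambda>i. y i \<rightleftharpoons> x i)"
    by (rule ent_iffI) (rule ent_iffD1[OF conj_fst conj_snd] ent_iffD2[OF conj_fst conj_snd])+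
  let ?H = "\<lambda>i. (x i \<rightleftharpoons> y i) \<sqinter> (y i \<rightleftharpoons> z i)"
  have 1: "(\<lambda>i. ?H i \<sqinter> u i) \<turnstile> (\<lambda>i. x i \<rightleftharpoons> y i)"
    and 2: "(\<lambda>i. ?H i \<sqinter> u i) \<turnstile> (\<lambda>i. y i \<rightleftharpoons> z i)" for u
    by (rule ent_weaken conj_fst conj_snd)+
  show "?H \<turnstile> (\<lambda>i. x i \<rightleftharpoons> z i)"
    by (intro ent_iffI ent_iffD1[OF 2 ent_iffD1[OF 1 conj_snd]]
        ent_iffD2[OF 1 ent_iffD2[OF 2 conj_snd]])
qed

lemma eqv_Omega [simp]: "eqv Omega = (\<rightleftharpoons>)"
  and carr_Omega [simp]: "carr Omega = UNIV"
  by (simp_all add: Omega_def)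

lemma eqv_prod:
  "eqv (rt_prod X Y) x y = eqv X (fst x) (fst y) \<sqinter> eqv Y (snd x) (snd y)"
  by (simp add: rt_prod_def case_prod_beta)

lemma unif_prod:
  assumes X: "unif_obj X" and Y: "unif_obj Y"
  shows "unif_obj (rt_prod X Y)"
proof (rule unif_objI)
  show "carr (rt_prod X Y) = UNIV"
    using assms by (simp add: rt_prod_def unif_obj_def)
next
  fix x y z :: "_ \<Rightarrow> _ \<times> _"
  show "H \<turnstile> (\<lambda>i. eqv (rt_prod X Y) (x i) (x i))" for H
    unfolding eqv_prod by (intro ent_conjI unif_refl X Y)
  show "(\<lambda>i. eqv (rt_prod X Y) (x i) (y i)) \<turnstile> (\<lambda>i. eqv (rt_prod X Y) (y i) (x i))"
    unfolding eqv_prod by (rule ent_conjI[OF unif_sym[OF X conj_fst] unif_sym[OF Y conj_snd]])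
  show "(\<lambda>i. eqv (rt_prod X Y) (x i) (y i) \<sqinter> eqv (rt_prod X Y) (y i) (z i))
      \<turnstile> (\<lambda>i. eqv (rt_prod X Y) (x i) (z i))"
    unfolding eqv_prod
  proof (rule ent_conjI)
    show "(\<lambda>i. (eqv X (fst (x i)) (fst (y i)) \<sqinter> eqv Y (snd (x i)) (snd (y i))) \<sqinter>
              eqv X (fst (y i)) (fst (z i)) \<sqinter> eqv Y (snd (y i)) (snd (z i)))
       \<turnstile> (\<lambda>i. eqv X (fst (x i)) (fst (z i)))"
      by (rule unif_trans[OF X ent_conjD1[OF conj_fst] ent_conjD1[OF conj_snd]])
    show "(\<lambda>i. (eqv X (fst (x i)) (fst (y i)) \<sqinter> eqv Y (snd (x i)) (snd (y i))) \<sqinter>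
              eqv X (fst (y i)) (fst (z i)) \<sqinter> eqv Y (snd (y i)) (snd (z i)))
       \<turnstile> (\<lambda>i. eqv Y (snd (x i)) (snd (z i)))"
      by (rule unif_trans[OF Y ent_conjD2[OF conj_fst] ent_conjD2[OF conj_snd]])
  qed
qed

definition extensional :: "('x, 'a) rt_obj \<Rightarrow> ('y, 'a) rt_obj \<Rightarrow> ('x \<Rightarrow> 'y) \<Rightarrow> bool" where
  "extensional X Y \<phi> \<longleftrightarrow> valid (\<Inter>x. \<Inter>x'. eqv X x x' \<rightharpoonup> eqv Y (\<phi> x) (\<phi> x'))"

definition graph :: "('y, 'a) rt_obj \<Rightarrow> ('x \<Rightarrow> 'y) \<Rightarrow> 'x \<Rightarrow> 'y \<Rightarrow> 'a set" where
  "graph Y \<phi> x y = eqv Y (\<phi> x) y"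

lemma to_Omega_graph: "to_Omega \<phi> = graph Omega \<phi>"
  by (simp add: fun_eq_iff to_Omega_def graph_def)

lemma extensionalD:
  "extensional X Y \<phi> \<Longrightarrow> H \<turnstile> (\<lambda>i. eqv X (x i) (x' i)) \<Longrightarrow>
   H \<turnstile> (\<lambda>i. eqv Y (\<phi> (x i)) (\<phi> (x' i)))"
  unfolding extensional_def by (rule ent_mp[OF validD2[of "\<lambda>x x'. eqv X x x' \<rightharpoonup> _ x x'"]])

lemma extensional_comp:
  "extensional X Y \<phi> \<Longrightarrow> extensional Y Z \<psi> \<Longrightarrow> extensional X Z (\<psi> \<circ> \<phi>)"
  unfolding extensional_def[of X Z] comp_def
  by (intro validI2 ent_impI_closed extensionalD[of Y Z] extensionalD[of X Y] ent_refl)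

lemma rel_equivI:
  assumes "carr X = UNIV" "carr Y = UNIV"
    and "\<And>x y. (\<lambda>i :: 'x \<times> 'y. F (x i) (y i)) \<turnstile> (\<lambda>i. G (x i) (y i))"
    and "\<And>x y. (\<lambda>i :: 'x \<times> 'y. G (x i) (y i)) \<turnstile> (\<lambda>i. F (x i) (y i))"
  shows "rel_equiv (X :: ('x, 'a) rt_obj) (Y :: ('y, 'a) rt_obj) F G"
  unfolding rel_equiv_def assms(1,2) by (intro validI2 ent_iffI_closed assms)

lemma rel_equivD:
  assumes "rel_equiv X Y F G" "carr X = UNIV" "carr Y = UNIV"
  shows "H \<turnstile> (\<lambda>i. F (x i) (y i) \<rightleftharpoons> G (x i) (y i))"
proof -
  have "valid (\<Inter>x. \<Inter>y. F x y \<rightleftharpoons> G x y)"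
    using assms by (simp add: rel_equiv_def)
  from validD2[OF this] show ?thesis .
qed

lemma functional_graph:
  assumes X: "unif_obj X" and Y: "unif_obj Y" and \<phi>: "extensional X Y \<phi>"
  shows "functional_rel X Y (graph Y \<phi>)"
proof -
  have carr: "carr X = UNIV" "carr Y = UNIV"
    using X Y by (simp_all add: unif_obj_def)
  show ?thesis
    unfolding functional_rel_def carr graph_def
  proof (intro conjI validI4 validI3 validI2 validI1 ent_impI_closed)
    show "p \<turnstile> (\<lambda>i. eqv X (x i) (x i) \<sqinter> eqv Y (y i) (y i))" for p and x y
      by (intro ent_conjI unif_refl X Y)
    show "(\<lambda>i. eqv Y (\<phi> (x i)) (y i) \<sqinter> eqv X (x i) (x' i) \<sqinter> eqv Y (y i) (y' i))
       \<turnstile> (\<lambda>i. eqv Y (\<phi> (x' i)) (y' i))" (is "?H \<turnstile> _") for x x' y y'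
    proof -
      have "?H \<turnstile> (\<lambda>i. eqv Y (\<phi> (x' i)) (\<phi> (x i)))"
        by (rule extensionalD[OF \<phi> unif_sym[OF X ent_conjD1[OF conj_snd]]])
      then have "?H \<turnstile> (\<lambda>i. eqv Y (\<phi> (x' i)) (y i))"
        by (rule unif_trans[OF Y _ conj_fst])
      then show ?thesis
        by (rule unif_trans[OF Y _ ent_conjD2[OF conj_snd]])
    qed
    show "(\<lambda>i. eqv Y (\<phi> (x i)) (y i) \<sqinter> eqv Y (\<phi> (x i)) (y' i)) \<turnstile> (\<lambda>i. eqv Y (y i) (y' i))"
      for x y y'
      by (rule unif_trans[OF Y unif_sym[OF Y conj_fst] conj_snd])
    show "(\<lambda>x. eqv X x x) \<turnstile> (\<lambda>x. \<Union>y. eqv Y (\<phi> x) y)"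
      by (rule ent_UnI[where y = \<phi>]) (rule unif_refl[OF Y])
  qed
qed

section \<open>Morphisms named by extensional maps\<close>

text \<open>Stated for an arbitrary set \<open>f\<close>, so that it applies to the unions of
  classes in \<open>rt_comp\<close> and \<open>rt_prod_map\<close>. That \<open>f\<close> is closed
  under equivalence is not part of it; \<open>names_mem\<close> obtains this from
  \<open>rt_hom\<close>.\<close>

definition names ::
  "('x, 'a) rt_obj \<Rightarrow> ('y, 'a) rt_obj \<Rightarrow> ('x \<Rightarrow> 'y) \<Rightarrow> ('x \<Rightarrow> 'y \<Rightarrow> 'a set) set \<Rightarrow> bool" where
  "names X Y \<phi> f \<longleftrightarrow> extensional X Y \<phi> \<and> graph Y \<phi> \<in> f \<and> (\<forall>F\<in>f. rel_equiv X Y F (graph Y \<phi>))"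

lemma rel_equiv_sym:
  assumes "carr X = UNIV" "carr Y = UNIV" "rel_equiv X Y F G"
  shows "rel_equiv X Y G F"
  by (rule rel_equivI[OF assms(1,2)])
    (rule ent_iffD1[OF rel_equivD[OF assms(3,1,2)] ent_refl]
      ent_iffD2[OF rel_equivD[OF assms(3,1,2)] ent_refl])+

lemma rel_equiv_trans:
  assumes "carr X = UNIV" "carr Y = UNIV" "rel_equiv X Y F G" "rel_equiv X Y G H"
  shows "rel_equiv X Y F H"
  by (rule rel_equivI[OF assms(1,2)])
    (rule ent_iffD1[OF rel_equivD[OF assms(4,1,2)] ent_iffD1[OF rel_equivD[OF assms(3,1,2)] ent_refl]]
      ent_iffD2[OF rel_equivD[OF assms(3,1,2)] ent_iffD2[OF rel_equivD[OF assms(4,1,2)] ent_refl]])+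

text \<open>The graph is functional and so belongs to the class; every other member is linked to it
  through \<open>F\<close>.\<close>

lemma names_class:
  assumes "unif_obj X" "unif_obj Y" "extensional X Y \<phi>" "rel_equiv X Y F (graph Y \<phi>)"
  shows "names X Y \<phi> (rt_class X Y F)"
  using assms functional_graph[OF assms(1-3)] rel_equiv_sym rel_equiv_trans
  unfolding names_def rt_class_def unif_obj_def by blast

lemma names_graph_class:
  assumes "unif_obj X" "unif_obj Y" "extensional X Y \<phi>"
  shows "names X Y \<phi> (rt_class X Y (graph Y \<phi>))"
proof (rule names_class[OF assms])
  show "rel_equiv X Y (graph Y \<phi>) (graph Y \<phi>)"
    using assms by (intro rel_equivI ent_refl) (simp_all add: unif_obj_def)
qed

text \<open>Each choice of representatives gives a class named by the same \<open>\<chi>\<close>,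
  and the graphs supply one choice, so the union is named by \<open>\<chi>\<close> too.\<close>

lemma names_UN_class:
  assumes "names X Y \<phi> f" "names U W \<psi> g"
    and "\<And>F G. rel_equiv X Y F (graph Y \<phi>) \<Longrightarrow> rel_equiv U W G (graph W \<psi>) \<Longrightarrow>
           names S T \<chi> (rt_class S T (h F G))"
  shows "names S T \<chi> (\<Union>F\<in>f. \<Union>G\<in>g. rt_class S T (h F G))"
  using assms(1,2) assms(3)[of "graph Y \<phi>" "graph W \<psi>"] assms(3)
  unfolding names_def by blast

lemma names_comp:
  assumes X: "unif_obj X" and Y: "unif_obj Y" and Z: "unif_obj Z"
    and f: "names X Y \<phi> f" and g: "names Y Z \<psi> g"
  shows "names X Z (\<psi> \<circ> \<phi>) (rt_comp X Y Z g f)"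
  unfolding rt_comp_def
proof (rule names_UN_class[OF f g])
  fix F G assume F: "rel_equiv X Y F (graph Y \<phi>)" and G: "rel_equiv Y Z G (graph Z \<psi>)"
  have carr: "carr X = UNIV" "carr Y = UNIV" "carr Z = UNIV"
    using X Y Z by (simp_all add: unif_obj_def)
  have ext: "extensional X Y \<phi>" "extensional Y Z \<psi>"
    using f g by (simp_all add: names_def)
  note F = rel_equivD[OF F carr(1,2), unfolded graph_def]
  note G = rel_equivD[OF G carr(2,3), unfolded graph_def]
  have "rel_equiv X Z (\<lambda>x z. \<Union>y. F x y \<sqinter> G y z) (graph Z (\<psi> \<circ> \<phi>))"
    unfolding graph_def comp_def
  proof (rule rel_equivI[OF carr(1,3)])
    show "(\<lambda>i. \<Union>y. F (x i) y \<sqinter> G y (z i)) \<turnstile> (\<lambda>i. eqv Z (\<psi> (\<phi> (x i))) (z i))" for x z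
    proof (rule ent_UnE_left)
      fix j y
      let ?H = "\<lambda>i. F (x (j i)) (y i) \<sqinter> G (y i) (z (j i))"
      have "?H \<turnstile> (\<lambda>i. eqv Y (\<phi> (x (j i))) (y i))"
        by (rule ent_iffD1[OF F conj_fst])
      then have "?H \<turnstile> (\<lambda>i. eqv Z (\<psi> (\<phi> (x (j i)))) (\<psi> (y i)))"
        by (rule extensionalD[OF ext(2)])
      moreover have "?H \<turnstile> (\<lambda>i. eqv Z (\<psi> (y i)) (z (j i)))"
        by (rule ent_iffD1[OF G conj_snd])
      ultimately show "?H \<turnstile> (\<lambda>i. eqv Z (\<psi> (\<phi> (x (j i)))) (z (j i)))"
        by (rule unif_trans[OF Z])
    qed
    show "(\<lambda>i. eqv Z (\<psi> (\<phi> (x i))) (z i)) \<turnstile> (\<lambda>i. \<Union>y. F (x i) y \<sqinter> G y (z i))" for x z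
      \<comment> \<open>The intermediate value can be taken to be exactly
        \<open>\<phi> (x i)\<close>, where the graph of \<open>\<phi>\<close> holds by
        reflexivity.\<close>
      by (rule ent_UnI[where y = "\<lambda>i. \<phi> (x i)"])
        (rule ent_conjI[OF ent_iffD2[OF F unif_refl[OF Y]] ent_iffD2[OF G ent_refl]])
  qed
  then show "names X Z (\<psi> \<circ> \<phi>) (rt_class X Z (\<lambda>x z. \<Union>y\<in>carr Y. F x y \<sqinter> G y z))"
    unfolding carr by (rule names_class[OF X Z extensional_comp[OF ext]])
qed

lemma names_prod_map:
  assumes X: "unif_obj X" and Y: "unif_obj Y" and U: "unif_obj U" and W: "unif_obj W"
    and f: "names X U \<phi> f" and g: "names Y W \<psi> g"
  shows "names (rt_prod X Y) (rt_prod U W) (map_prod \<phi> \<psi>) (rt_prod_map X Y U W f g)"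
  unfolding rt_prod_map_def
proof (rule names_UN_class[OF f g])
  fix F G assume F: "rel_equiv X U F (graph U \<phi>)" and G: "rel_equiv Y W G (graph W \<psi>)"
  note XY = unif_prod[OF X Y] and UW = unif_prod[OF U W]
  have carr: "carr X = UNIV" "carr Y = UNIV" "carr U = UNIV" "carr W = UNIV"
    "carr (rt_prod X Y) = UNIV" "carr (rt_prod U W) = UNIV"
    using X Y U W XY UW by (simp_all add: unif_obj_def)
  have ext: "extensional X U \<phi>" "extensional Y W \<psi>"
    using f g by (simp_all add: names_def)
  note F = rel_equivD[OF F carr(1,3), unfolded graph_def]
  note G = rel_equivD[OF G carr(2,4), unfolded graph_def]
  have "rel_equiv (rt_prod X Y) (rt_prod U W) (\<lambda>(x, y) (u, v). F x u \<sqinter> G y v)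
          (graph (rt_prod U W) (map_prod \<phi> \<psi>))"
    unfolding graph_def eqv_prod fst_map_prod snd_map_prod case_prod_beta
    by (rule rel_equivI[OF carr(5,6)])
      (rule ent_conjI[OF ent_iffD1[OF F conj_fst] ent_iffD1[OF G conj_snd]]
        ent_conjI[OF ent_iffD2[OF F conj_fst] ent_iffD2[OF G conj_snd]])+
  moreover have "extensional (rt_prod X Y) (rt_prod U W) (map_prod \<phi> \<psi>)"
    unfolding extensional_def eqv_prod fst_map_prod snd_map_prod
    by (intro validI2 ent_impI_closed ent_conjI extensionalD[OF ext(1)] extensionalD[OF ext(2)]
        conj_fst conj_snd)
  ultimately show "names (rt_prod X Y) (rt_prod U W) (map_prod \<phi> \<psi>)
    (rt_class (rt_prod X Y) (rt_prod U W) (\<lambda>(x, y) (u, v). F x u \<sqinter> G y v))"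
    by (intro names_class XY UW)
qed

text \<open>The two graphs are equivalent; at the point \<open>(x, \<psi> x)\<close> the graph of
  \<open>\<psi>\<close> holds by reflexivity, hence so does that of \<open>\<phi>\<close>.\<close>

lemma names_unique:
  assumes X: "unif_obj X" and Y: "unif_obj Y" and "names X Y \<phi> f" "names X Y \<psi> f"
  shows "H \<turnstile> (\<lambda>i. eqv Y (\<phi> (x i)) (\<psi> (x i)))"
proof -
  have "rel_equiv X Y (graph Y \<psi>) (graph Y \<phi>)" "carr X = UNIV" "carr Y = UNIV"
    using assms by (simp_all add: names_def unif_obj_def)
  from ent_iffD1[OF rel_equivD[OF this, unfolded graph_def] unif_refl[OF Y]] show ?thesis .
qed

section \<open>Functional relations into \<open>Omega\<close> are graphs\<close>

lemma functional_rel_cong: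
  assumes F: "functional_rel X Y F" and carr: "carr X = UNIV" "carr Y = UNIV"
    and H: "H \<turnstile> (\<lambda>i. F (x i) (y i))" "H \<turnstile> (\<lambda>i. eqv X (x i) (x' i))" "H \<turnstile> (\<lambda>i. eqv Y (y i) (y' i))"
  shows "H \<turnstile> (\<lambda>i. F (x' i) (y' i))"
proof -
  have "valid (\<Inter>x. \<Inter>x'. \<Inter>y. \<Inter>y'. F x y \<sqinter> eqv X x x' \<sqinter> eqv Y y y' \<rightharpoonup> F x' y')"
    using F unfolding functional_rel_def carr by (elim conjE)
  from ent_mp[OF validD4[OF this] ent_conjI[OF H(1) ent_conjI[OF H(2,3)]]] show ?thesis .
qed

lemma functional_rel_unique:
  assumes F: "functional_rel X Y F" and carr: "carr X = UNIV" "carr Y = UNIV"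
    and H: "H \<turnstile> (\<lambda>i. F (x i) (y i))" "H \<turnstile> (\<lambda>i. F (x i) (y' i))"
  shows "H \<turnstile> (\<lambda>i. eqv Y (y i) (y' i))"
proof -
  have "valid (\<Inter>x. \<Inter>y. \<Inter>y'. F x y \<sqinter> F x y' \<rightharpoonup> eqv Y y y')"
    using F unfolding functional_rel_def carr by (elim conjE)
  from ent_mp[OF validD3[OF this] ent_conjI[OF H]] show ?thesis .
qed

lemma functional_rel_total:
  assumes F: "functional_rel X Y F" and carr: "carr X = UNIV" "carr Y = UNIV"
    and H: "H \<turnstile> (\<lambda>i. eqv X (x i) (x i))"
  shows "H \<turnstile> (\<lambda>i. \<Union>y. F (x i) y)"
proof -
  have "valid (\<Inter>x. eqv X x x \<rightharpoonup> (\<Union>y. F x y))"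
    using F unfolding functional_rel_def carr by (elim conjE)
  from ent_mp[OF validD[OF this] H] show ?thesis .
qed

text \<open>\<open>\<phi> x\<close> says that the value of \<open>F\<close> at \<open>x\<close> is
  true, and a truth value is determined up to equivalence by its being true. Single-valuedness makes
  \<open>\<phi> x\<close> equivalent to any \<open>q\<close> with \<open>F x q\<close>; totality and
  congruence give the converse.\<close>

lemma functional_rel_Omega_graph:
  assumes X: "unif_obj X" and F: "functional_rel X Omega F"
  defines "\<phi> \<equiv> \<lambda>x. \<Union>q. F x q \<sqinter> q"
  shows "extensional X Omega \<phi> \<and> rel_equiv X Omega F (graph Omega \<phi>)"
proof -
  have carr: "carr X = UNIV"
    using X by (simp add: unif_obj_def)
  note F_cong = functional_rel_cong[OF F carr carr_Omega]
    and F_unique = functional_rel_unique[OF F carr carr_Omega, unfolded eqv_Omega]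
    and F_total = functional_rel_total[OF F carr carr_Omega]
  have transport: "(\<lambda>i. eqv X (x i) (x' i) \<sqinter> \<phi> (x i)) \<turnstile> (\<lambda>i. \<phi> (x' i))"
    for x x' :: "'i \<Rightarrow> _"
    unfolding \<phi>_def
  proof (rule ent_UnE[OF conj_snd], rule ent_UnI)
    fix j :: "'i \<times> 'a set \<Rightarrow> 'i" and q :: "'i \<times> 'a set \<Rightarrow> 'a set"
    let ?H = "\<lambda>i. (eqv X (x (j i)) (x' (j i)) \<sqinter> (\<Union>q. F (x (j i)) q \<sqinter> q)) \<sqinter> F (x (j i)) (q i) \<sqinter> q i"
    show "?H \<turnstile> (\<lambda>i. F (x' (j i)) (q i) \<sqinter> q i)"
      by (rule ent_conjI[OF F_cong[OF ent_conjD1[OF conj_snd] ent_conjD1[OF conj_fst]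
              unif_refl[OF unif_Omega]] ent_conjD2[OF conj_snd]])
  qed
  have ext: "extensional X Omega \<phi>"
    unfolding extensional_def eqv_Omega
  proof (intro validI2 ent_impI_closed ent_iffI)
    fix x x' :: "_ \<times> _ \<Rightarrow> _"
    show "(\<lambda>i. eqv X (x i) (x' i) \<sqinter> \<phi> (x i)) \<turnstile> (\<lambda>i. \<phi> (x' i))"
      by (rule transport)
    show "(\<lambda>i. eqv X (x i) (x' i) \<sqinter> \<phi> (x' i)) \<turnstile> (\<lambda>i. \<phi> (x i))"
      by (rule ent_trans[OF ent_conjI[OF unif_sym[OF X conj_fst] conj_snd] transport])
  qed
  have fwd: "(\<lambda>i. F (x i) (q i)) \<turnstile> (\<lambda>i. \<phi> (x i) \<rightleftharpoons> q i)" for x and q :: "'i \<Rightarrow> _"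
  proof (rule ent_iffI)
    show "(\<lambda>i. F (x i) (q i) \<sqinter> q i) \<turnstile> (\<lambda>i. \<phi> (x i))"
      unfolding \<phi>_def by (rule ent_UnI[OF ent_refl])
    show "(\<lambda>i. F (x i) (q i) \<sqinter> \<phi> (x i)) \<turnstile> q"
      unfolding \<phi>_def
    proof (rule ent_UnE[OF conj_snd])
      fix j :: "'i \<times> 'a set \<Rightarrow> 'i" and u :: "'i \<times> 'a set \<Rightarrow> 'a set"
      let ?H = "\<lambda>i. (F (x (j i)) (q (j i)) \<sqinter> (\<Union>q. F (x (j i)) q \<sqinter> q)) \<sqinter> F (x (j i)) (u i) \<sqinter> u i"
      have "?H \<turnstile> (\<lambda>i. u i \<rightleftharpoons> q (j i))"
        by (rule F_unique[OF ent_conjD1[OF conj_snd] ent_conjD1[OF conj_fst]])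
      from ent_iffD1[OF this ent_conjD2[OF conj_snd]] show "?H \<turnstile> (\<lambda>i. q (j i))" .
    qed
  qed
  have bwd: "(\<lambda>i. \<phi> (x i) \<rightleftharpoons> q i) \<turnstile> (\<lambda>i. F (x i) (q i))" for x and q :: "'i \<Rightarrow> _"
  proof (rule ent_UnE[OF F_total[OF unif_refl[OF X]]])
    fix j :: "'i \<times> 'a set \<Rightarrow> 'i" and u :: "'i \<times> 'a set \<Rightarrow> 'a set"
    let ?H = "\<lambda>i. (\<phi> (x (j i)) \<rightleftharpoons> q (j i)) \<sqinter> F (x (j i)) (u i)"
    have "?H \<turnstile> (\<lambda>i. \<phi> (x (j i)) \<rightleftharpoons> u i)"
      by (rule ent_trans[OF conj_snd fwd])
    then have "?H \<turnstile> (\<lambda>i. u i \<rightleftharpoons> q (j i))"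
      by (rule unif_trans[OF unif_Omega unif_sym[OF unif_Omega], unfolded eqv_Omega, OF _ conj_fst])
    then show "?H \<turnstile> (\<lambda>i. F (x (j i)) (q (j i)))"
      by (rule F_cong[OF conj_snd unif_refl[OF X], unfolded eqv_Omega])
  qed
  have "rel_equiv X Omega F (graph Omega \<phi>)"
    by (rule rel_equivI[OF carr carr_Omega]; unfold graph_def eqv_Omega; rule fwd bwd)
  with ext show ?thesis ..
qed

section \<open>Local operators and their generation by oracle calls\<close>

text \<open>Being a morphism, \<open>j\<close> is a full equivalence class, so it contains every
  functional relation equivalent to the graph that names it.\<close>

lemma names_mem:
  assumes j: "j \<in> rt_hom X Y" "names X Y \<phi> j" and carr: "carr X = UNIV" "carr Y = UNIV"
    and G: "functional_rel X Y G" "rel_equiv X Y G (graph Y \<phi>)"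
  shows "G \<in> j"
proof -
  obtain F where F: "j = rt_class X Y F"
    using j(1) by (auto simp: rt_hom_def)
  then have "rel_equiv X Y (graph Y \<phi>) F"
    using j(2) by (simp add: names_def rt_class_def)
  then show ?thesis
    using rel_equiv_trans[OF carr G(2)] G(1) by (simp add: F rt_class_def)
qed

lemma extensional_meet: "extensional (rt_prod Omega Omega) Omega (\<lambda>(p, q). p \<sqinter> q)"
  unfolding extensional_def eqv_prod eqv_Omega case_prod_beta
proof (intro validI2 ent_impI_closed ent_iffI)
  fix x y :: "_ \<Rightarrow> 'a set \<times> 'a set"
  let ?H = "\<lambda>i. (fst (x i) \<rightleftharpoons> fst (y i)) \<sqinter> (snd (x i) \<rightleftharpoons> snd (y i))"
  have 1: "(\<lambda>i. ?H i \<sqinter> u i) \<turnstile> (\<lambda>i. fst (x i) \<rightleftharpoons> fst (y i))"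
    and 2: "(\<lambda>i. ?H i \<sqinter> u i) \<turnstile> (\<lambda>i. snd (x i) \<rightleftharpoons> snd (y i))" for u
    by (rule ent_weaken conj_fst conj_snd)+
  show "(\<lambda>i. ?H i \<sqinter> (fst (x i) \<sqinter> snd (x i))) \<turnstile> (\<lambda>i. fst (y i) \<sqinter> snd (y i))"
    by (rule ent_conjI[OF ent_iffD1[OF 1 ent_conjD1[OF conj_snd]]
          ent_iffD1[OF 2 ent_conjD2[OF conj_snd]]])
  show "(\<lambda>i. ?H i \<sqinter> (fst (y i) \<sqinter> snd (y i))) \<turnstile> (\<lambda>i. fst (x i) \<sqinter> snd (x i))"
    by (rule ent_conjI[OF ent_iffD2[OF 1 ent_conjD1[OF conj_snd]]
          ent_iffD2[OF 2 ent_conjD2[OF conj_snd]]])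
qed

text \<open>Preservation of meets gives monotonicity, because \<open>p \<rightharpoonup> q\<close> entails \<open>p \<rightleftharpoons> p \<sqinter> q\<close>.\<close>

lemma lawvere_tierney_monad:
  assumes "lawvere_tierney j"
  obtains J where "names Omega Omega J j" "(\<lambda>S. S) \<turnstile> J"
    "(\<lambda>(T, S). J T \<sqinter> (T \<rightharpoonup> J S)) \<turnstile> (\<lambda>(T, S). J S)"
proof -
  note \<Omega> = unif_Omega and \<Omega>\<Omega> = unif_prod[OF unif_Omega unif_Omega]
  have j: "j \<in> rt_hom Omega Omega"
    and j_true: "rt_comp rt_one Omega Omega j rt_true = rt_true"
    and j_idem: "rt_comp Omega Omega Omega j j = j"
    and j_meet: "rt_comp (rt_prod Omega Omega) Omega Omega j rt_meet =
      rt_comp (rt_prod Omega Omega) (rt_prod Omega Omega) Omega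
        rt_meet (rt_prod_map Omega Omega Omega Omega j j)"
    using assms by (auto simp: lawvere_tierney_def)
  obtain F where F: "j = rt_class Omega Omega F" "functional_rel Omega Omega F"
    using j by (auto simp: rt_hom_def)
  define J where "J x = (\<Union>q. F x q \<sqinter> q)" for x
  have J: "extensional Omega Omega J" "rel_equiv Omega Omega F (graph Omega J)"
    using functional_rel_Omega_graph[OF \<Omega> F(2)] unfolding J_def by auto
  have nj: "names Omega Omega J j"
    unfolding F(1) by (rule names_class[OF \<Omega> \<Omega> J])
  have J_cong: "H \<turnstile> (\<lambda>i. J (p i) \<rightleftharpoons> J (q i))" if "H \<turnstile> (\<lambda>i. p i \<rightleftharpoons> q i)" for H p q
    using extensionalD[OF J(1), of H p q] that by simp
  have "extensional rt_one Omega (\<lambda>_. UNIV)"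
    unfolding extensional_def eqv_Omega
    by (intro validI2 ent_impI_closed ent_iffI_closed ent_refl)
  then have n_true: "names rt_one Omega (\<lambda>_. UNIV) rt_true"
    unfolding rt_true_def to_Omega_graph by (rule names_graph_class[OF unif_one \<Omega>])
  have n_meet: "names (rt_prod Omega Omega) Omega (\<lambda>(p, q). p \<sqinter> q) rt_meet"
    unfolding rt_meet_def to_Omega_graph by (rule names_graph_class[OF \<Omega>\<Omega> \<Omega> extensional_meet])
  have J_true: "H \<turnstile> (\<lambda>_. J UNIV)" for H
  proof -
    have "H \<turnstile> (\<lambda>i. J UNIV \<rightleftharpoons> UNIV)"
      using names_unique[OF unif_one \<Omega> names_comp[OF unif_one \<Omega> \<Omega> n_true nj, unfolded j_true] n_true]
      by simp
    then show ?thesis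
      by (rule ent_iffD2[OF _ ent_UNIV])
  qed
  have J_idem: "H \<turnstile> (\<lambda>i. J (J (p i)) \<rightleftharpoons> J (p i))" for H p
    using names_unique[OF \<Omega> \<Omega> names_comp[OF \<Omega> \<Omega> \<Omega> nj nj, unfolded j_idem] nj] by simp
  have J_meet: "H \<turnstile> (\<lambda>i. J (p i \<sqinter> q i) \<rightleftharpoons> J (p i) \<sqinter> J (q i))" for H p q
    \<comment> \<open>Both sides of the meet axiom are named: one by the meet followed by
      \<open>J\<close>, the other by \<open>J\<close> on each component followed by the
      meet.\<close>
    using names_unique[OF \<Omega>\<Omega> \<Omega> names_comp[OF \<Omega>\<Omega> \<Omega> \<Omega> n_meet nj, unfolded j_meet]
        names_comp[OF \<Omega>\<Omega> \<Omega>\<Omega> \<Omega> names_prod_map[OF \<Omega> \<Omega> \<Omega> \<Omega> nj nj] n_meet],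
        of H "\<lambda>i. (p i, q i)"]
    by simp
  have unit: "(\<lambda>S. S) \<turnstile> J"
  proof -
    \<comment> \<open>A truth value that holds is equivalent to truth; \<open>J\<close> respects
      equivalence and sends truth to something true.\<close>
    have "(\<lambda>S. S) \<turnstile> (\<lambda>S. S \<rightleftharpoons> UNIV)"
      by (rule ent_iffI[OF ent_UNIV conj_fst])
    from ent_iffD2[OF J_cong[OF this] J_true] show ?thesis .
  qed
  have mono: "H \<turnstile> (\<lambda>i. J (q i))" if "H \<turnstile> (\<lambda>i. p i \<rightharpoonup> q i)" "H \<turnstile> (\<lambda>i. J (p i))"
    for H :: "'i \<Rightarrow> 'a set" and p q
  proof -
    have "H \<turnstile> (\<lambda>i. p i \<rightleftharpoons> p i \<sqinter> q i)"
      by (rule ent_iffI[OF ent_conjI[OF conj_snd ent_mp[OF ent_weaken[OF that(1)] conj_snd]]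
            ent_conjD1[OF conj_snd]])
    from ent_iffD1[OF J_cong[OF this] that(2)] have "H \<turnstile> (\<lambda>i. J (p i \<sqinter> q i))" .
    from ent_conjD2[OF ent_iffD1[OF J_meet this]] show ?thesis .
  qed
  have bind: "(\<lambda>(T, S). J T \<sqinter> (T \<rightharpoonup> J S)) \<turnstile> (\<lambda>(T, S). J S)"
    \<comment> \<open>Monotonicity along \<open>T \<rightharpoonup> J S\<close> leads from
      \<open>J T\<close> to \<open>J (J S)\<close>, and idempotence from there to
      \<open>J S\<close>.\<close>
    unfolding case_prod_beta by (rule ent_iffD1[OF J_idem mono[OF conj_snd conj_fst]])
  show ?thesis
    using that nj unit bind by blast
qed

text \<open>\<open>K\<close> inherits extensionality from \<open>J\<close>, so its graph is
  functional and equivalent to that of \<open>J\<close>, hence a member of the class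
  \<open>j\<close>.\<close>

lemma represented_by_cong:
  assumes j: "j \<in> rt_hom Omega Omega" "names Omega Omega J j" and K: "J \<turnstile> K" "K \<turnstile> J"
  shows "represented_by j K"
proof -
  note \<Omega> = unif_Omega
  have JK: "H \<turnstile> (\<lambda>i. J (p i) \<rightleftharpoons> K (p i))" for H p
    by (rule ent_iffI_closed[OF ent_reindex[OF K(1)] ent_reindex[OF K(2)]])
  have J: "extensional Omega Omega J"
    using j(2) by (simp add: names_def)
  have \<Omega>_sym: "H \<turnstile> (\<lambda>i. q i \<rightleftharpoons> p i)" if "H \<turnstile> (\<lambda>i. p i \<rightleftharpoons> q i)" for H p q
    using unif_sym[OF \<Omega>, of H p q] that by simp
  have \<Omega>_trans: "H \<turnstile> (\<lambda>i. p i \<rightleftharpoons> u i)" if "H \<turnstile> (\<lambda>i. p i \<rightleftharpoons> q i)" "H \<turnstile> (\<lambda>i. q i \<rightleftharpoons> u i)"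
    for H p q u
    using unif_trans[OF \<Omega>, of H p q u] that by simp
  have "extensional Omega Omega K"
    unfolding extensional_def eqv_Omega
  proof (intro validI2 ent_impI_closed)
    fix p q :: "_ \<Rightarrow> 'a set"
    have "(\<lambda>i. p i \<rightleftharpoons> q i) \<turnstile> (\<lambda>i. J (p i) \<rightleftharpoons> J (q i))"
      by (rule extensionalD[OF J, unfolded eqv_Omega, OF ent_refl])
    from \<Omega>_trans[OF \<Omega>_sym[OF JK] \<Omega>_trans[OF this JK]]
    show "(\<lambda>i. p i \<rightleftharpoons> q i) \<turnstile> (\<lambda>i. K (p i) \<rightleftharpoons> K (q i))" .
  qed
  then have "functional_rel Omega Omega (graph Omega K)"
    by (rule functional_graph[OF \<Omega> \<Omega>])
  moreover have "rel_equiv Omega Omega (graph Omega K) (graph Omega J)"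
    by (rule rel_equivI[OF carr_Omega carr_Omega]; unfold graph_def eqv_Omega)
      (rule \<Omega>_trans[OF JK ent_refl] \<Omega>_trans[OF \<Omega>_sym[OF JK] ent_refl])+
  ultimately show ?thesis
    unfolding represented_by_def to_Omega_graph by (rule names_mem[OF j carr_Omega carr_Omega])
qed

section \<open>Oracle dialogues generated by a local operator\<close>

definition generators :: "('a set \<Rightarrow> 'a set) \<Rightarrow> 'a \<Rightarrow> 'a set set" where
  "generators J b = {T. b \<in> J T}"

lemma O_weih_generators_ge: "J \<turnstile> O_weih (generators J)"
proof (rule entailsI)
  let ?t = "pair_trm (C (num 1)) (pair_trm (V 0) (lam 1 (pair_trm (C (num 0)) (V 1))))"
  show "set_trm ?t \<subseteq> A'"
    by (simp add: set_derived_trms num_sub del: num.simps)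
  fix S b assume "b \<in> J S"
  \<comment> \<open>The question \<open>b\<close> is put to \<open>S\<close> itself, which is in
    \<open>generators J b\<close> because \<open>b \<in> J S\<close>; an answer
    \<open>d \<in> S\<close> is returned as a leaf.\<close>
  then have "pair (num 1) (pair b c) \<in> O_weih (generators J) S"
    if "\<And>d. c \<cdot> d = Some (pair (num 0) d)" for c
    using that by (intro O_weih.ask[of S]) (auto simp: generators_def simp del: num.simps intro: O_weih.ret)
  then show "\<exists>c. eval ((\<lambda>_. k)(0 := b)) ?t = Some c \<and> c \<in> O_weih (generators J) S"
    by (simp del: num.simps)
qed

lemma O_weih_generators_le:
  assumes unit: "(\<lambda>S. S) \<turnstile> J" and bind: "(\<lambda>(T, S). J T \<sqinter> (T \<rightharpoonup> J S)) \<turnstile> (\<lambda>(T, S). J S)"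
  shows "O_weih (generators J) \<turnstile> J"
proof -
  obtain e h where eh: "e \<in> A'" "h \<in> A'"
    and e: "\<And>S a. a \<in> S \<Longrightarrow> \<exists>b. e \<cdot> a = Some b \<and> b \<in> J S"
    and h: "\<And>T S a. a \<in> J T \<sqinter> (T \<rightharpoonup> J S) \<Longrightarrow> \<exists>b. h \<cdot> a = Some b \<and> b \<in> J S"
    using assms by (auto simp: entails_def tv_imp_def)
  obtain r where r: "r \<in> A'" "\<And>a. r \<cdot> pair (num 0) a = e \<cdot> a"
    "\<And>b c. \<exists>v. (\<forall>d. v \<cdot> d = kleene_app app (Some r) (c \<cdot> d)) \<and>
              r \<cdot> pair (num 1) (pair b c) = h \<cdot> pair b v"
    using recursor_ex[OF eh] by blast
  \<comment> \<open>Induction over the dialogue proves at once that the recursion terminates and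
    that its value is in \<open>J S\<close>.\<close>
  have "\<exists>y. r \<cdot> x = Some y \<and> y \<in> J S" if "x \<in> O_weih (generators J) S" for x S
    using that
  proof induction
    case (ret a)
    then show ?case
      using e r(2) by simp
  next
    case (ask T b c)
    obtain v where v: "\<And>d. v \<cdot> d = kleene_app app (Some r) (c \<cdot> d)"
      "r \<cdot> pair (num 1) (pair b c) = h \<cdot> pair b v"
      using r(3)[of c b] by blast
    \<comment> \<open>\<open>v\<close> sends an answer \<open>d\<close> to \<open>r\<close> applied
      to \<open>c \<cdot> d\<close>, a smaller dialogue, so the induction hypothesis makes
      \<open>v\<close> the continuation that \<open>h\<close> expects.\<close>
    have "v \<in> T \<rightharpoonup> J S"
      unfolding tv_imp_def using ask.IH v(1) by fastforce
    then have "pair b v \<in> J T \<sqinter> (T \<rightharpoonup> J S)"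
      using ask.hyps by (auto simp: generators_def tv_conj_def)
    from h[OF this] show ?case
      by (simp only: v(2))
  qed
  then show ?thesis
    using r(1) by (auto simp: entails_def tv_imp_def)
qed

text \<open>A point of the assembly records the hidden set \<open>T\<close> together with the
  visible query \<open>b\<close>; \<open>\<rho>\<close> shows only \<open>b\<close>, and
  \<open>P\<close> is \<open>T\<close>. Questions then match exactly, which gives equality and not
  just equivalence.\<close>

lemma O_pred_eq_O_weih: "O_pred {(T, b). T \<in> f b} snd fst S = O_weih f S"
proof (intro equalityI subsetI)
  fix x assume "x \<in> O_pred {(T, b). T \<in> f b} snd fst S"
  then show "x \<in> O_weih f S"
  proof induction
    case (ask y c)
    then show ?case
      by (intro O_weih.ask[of "fst y"]) auto
  qed (rule O_weih.ret)
next
  fix x assume "x \<in> O_weih f S"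
  then show "x \<in> O_pred {(T, b). T \<in> f b} snd fst S"
  proof induction
    case (ask T b c)
    then show ?case
      using O_pred.ask[of "(T, b)" "{(T, b). T \<in> f b}" fst c snd S] by auto
  qed (rule O_pred.ret)
qed

end

theorem theorem41:
  fixes app :: "'a \<Rightarrow> 'a \<Rightarrow> 'a option" and k s :: 'a and A' :: "'a set"
    and j :: "('a set \<Rightarrow> 'a set \<Rightarrow> 'a set) set"
  assumes "elementary_subpca app k s A'"
    and "elementary_subpca.lawvere_tierney app k s A' j"
  shows "(\<exists>(X :: ('a set \<times> 'a) set) (\<rho> :: 'a set \<times> 'a \<Rightarrow> 'a) (P :: 'a set \<times> 'a \<Rightarrow> 'a set).
            elementary_subpca.represented_by app k s j (pca.O_pred app k s X \<rho> P)) \<and>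
         (\<exists>f :: 'a \<Rightarrow> 'a set set.
            elementary_subpca.represented_by app k s j (pca.O_weih app k s f))"
proof -
  interpret elementary_subpca app k s A'
    by (rule assms(1))
  obtain J where J: "names Omega Omega J j" "(\<lambda>S. S) \<turnstile> J"
    "(\<lambda>(T, S). J T \<sqinter> (T \<rightharpoonup> J S)) \<turnstile> (\<lambda>(T, S). J S)"
    using lawvere_tierney_monad[OF assms(2)] .
  let ?f = "generators J"
  have "j \<in> rt_hom Omega Omega"
    using assms(2) by (simp add: lawvere_tierney_def)
  then have weih: "represented_by j (O_weih ?f)"
    using J(1) O_weih_generators_ge O_weih_generators_le[OF J(2,3)] by (rule represented_by_cong)
  have "O_pred {(T, b). T \<in> ?f b} snd fst = O_weih ?f"
    by (rule ext) (rule O_pred_eq_O_weih)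
  with weih have "represented_by j (O_pred {(T, b). T \<in> ?f b} snd fst)"
    by (simp only:)
  with weih show ?thesis
    by blast
qed

end
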